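(* Let $A, B \subseteq \mathbb{N}$ be computable sets such that $B$ is not negligible and the complement $\mathbb{N}\setminus B$ is not negligible (i.e., $B$ does not have asymptotic density $0$ or $1$). Then $A \leq_{gm} B$. In particular, any two computable sets $A, B\subseteq\mathbb{N}$ each of which is not negligible and has non-negligible complement satisfy both $A \leq_{gm} B$ and $B \leq_{gm} A$.
   Context: For $A\subseteq \mathbb{N}$ and $n\ge 1$, $\rho_n(A) = \#\{k<n \mid k\in A\}/n$. The asymptotic density $\rho(A)$ is $\lim_n \rho_n(A)$ when this limit exists. A set $A$ is negligible if $\rho(A)=0$ (i.e., $\rho_n(A)\to 0$). A total function $f\colon\mathbb{N}\to\mathbb{N}$ is uniform if $f^{-1}(S)$ is negligible for every negligible $S\subseteq\mathbb{N}$. We write $A\leq_{gm} B$ ($A$ is generically m-reducible to $B$) if there is a uniform total computable function $f\colon\mathbb{N}\to\mathbb{N}$ such that for all $x\in\mathbb{N}$, $x\in A \iff f(x)\in B$. *)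

theory Defs
  imports Complex_Main
begin

text \<open>
  Computability is defined through the partial recursive functions: terms built from the basic
  functions by composition, primitive recursion and unbounded minimization, with a big-step
  evaluation relation on argument lists.  Arities are not tracked: \<open>Zero\<close> accepts any argument
  list, \<open>Succ\<close> ignores surplus arguments.  Primitive recursion and minimization act on the first
  argument; the step function of \<open>PrimRec\<close> receives the counter, the previous value and the
  parameters, in this order.
\<close>

datatype recf =
    Zero
  | Succ
  | Proj nat
  | Comp recf "recf list"
  | PrimRec recf recf
  | Mu recf

inductive rec_eval :: "recf \<Rightarrow> nat list \<Rightarrow> nat \<Rightarrow> bool" where
  Zero: "rec_eval Zero xs 0"
| Succ: "rec_eval Succ (x # xs) (Suc x)"
| Proj: "i < length xs \<Longrightarrow> rec_eval (Proj i) xs (xs ! i)"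
| Comp: "list_all2 (\<lambda>g y. rec_eval g xs y) gs ys \<Longrightarrow> rec_eval f ys z
          \<Longrightarrow> rec_eval (Comp f gs) xs z"
| PrimRec_0: "rec_eval f xs y \<Longrightarrow> rec_eval (PrimRec f g) (0 # xs) y"
| PrimRec_Suc: "rec_eval (PrimRec f g) (n # xs) y \<Longrightarrow> rec_eval g (n # y # xs) z
          \<Longrightarrow> rec_eval (PrimRec f g) (Suc n # xs) z"
| Mu: "rec_eval f (n # xs) 0 \<Longrightarrow> (\<forall>m<n. \<exists>y. rec_eval f (m # xs) (Suc y))
          \<Longrightarrow> rec_eval (Mu f) xs n"

inductive_cases rec_eval_ZeroE: "rec_eval Zero xs y"
inductive_cases rec_eval_SuccE: "rec_eval Succ xs y"
inductive_cases rec_eval_ProjE: "rec_eval (Proj i) xs y"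
inductive_cases rec_eval_CompE: "rec_eval (Comp f gs) xs y"
inductive_cases rec_eval_PrimRec_0E: "rec_eval (PrimRec f g) (0 # xs) y"
inductive_cases rec_eval_PrimRec_SucE: "rec_eval (PrimRec f g) (Suc n # xs) y"
inductive_cases rec_eval_MuE: "rec_eval (Mu f) xs y"

lemma rec_eval_deterministic:
  "rec_eval r xs y \<Longrightarrow> rec_eval r xs z \<Longrightarrow> y = z"
proof (induction r xs y arbitrary: z rule: rec_eval.induct)
  case (Zero xs)
  then show ?case by (auto elim: rec_eval_ZeroE)
next
  case (Succ x xs)
  then show ?case by (auto elim: rec_eval_SuccE)
next
  case (Proj i xs)
  then show ?case by (auto elim: rec_eval_ProjE)
next
  case (Comp xs gs ys f w)
  from Comp.prems obtain ys' where ys': "list_all2 (\<lambda>g y. rec_eval g xs y) gs ys'" "rec_eval f ys' z"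
    by (rule rec_eval_CompE)
  have "ys = ys'"
  proof (rule nth_equalityI)
    show len: "length ys = length ys'"
      using list_all2_lengthD [OF Comp.IH(1)] list_all2_lengthD [OF ys'(1)] by simp
    fix i assume i: "i < length ys"
    show "ys ! i = ys' ! i"
      using list_all2_nthD2 [OF Comp.IH(1) i] list_all2_nthD2 [OF ys'(1)] i len by simp
  qed
  with ys'(2) show ?case by (intro Comp.IH(2)) simp
next
  case (PrimRec_0 f xs y g)
  from PrimRec_0.prems show ?case
    by (rule rec_eval_PrimRec_0E) (rule PrimRec_0.IH)
next
  case (PrimRec_Suc f g n xs y w)
  from PrimRec_Suc.prems show ?case
    by (rule rec_eval_PrimRec_SucE) (use PrimRec_Suc.IH in simp)
next
  case (Mu f n xs)
  from Mu.prems obtain z: "rec_eval f (z # xs) 0" "\<forall>m<z. \<exists>y. rec_eval f (m # xs) (Suc y)"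
    by (rule rec_eval_MuE)
  have "\<not> z < n" using Mu.IH(2) z(1) by blast
  moreover have "\<not> n < z" using Mu.IH(1) z(2) by blast
  ultimately show ?case by simp
qed

definition computable_fun :: "(nat \<Rightarrow> nat) \<Rightarrow> bool" where
  "computable_fun f \<longleftrightarrow> (\<exists>r. \<forall>x. rec_eval r [x] (f x))"

definition computable_set :: "nat set \<Rightarrow> bool" where
  "computable_set A \<longleftrightarrow> computable_fun (\<lambda>x. if x \<in> A then 1 else 0)"

definition rho :: "nat \<Rightarrow> nat set \<Rightarrow> real" where
  "rho n A = real (card {k. k < n \<and> k \<in> A}) / real n"

definition has_density :: "nat set \<Rightarrow> real \<Rightarrow> bool" where
  "has_density A d \<longleftrightarrow> (\<lambda>n. rho n A) \<longlonglongrightarrow> d"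

definition negligible_set :: "nat set \<Rightarrow> bool" where
  "negligible_set A \<longleftrightarrow> has_density A 0"

lemma rho_Compl: "n \<ge> 1 \<Longrightarrow> rho n (- A) = 1 - rho n A"
proof -
  assume n: "n \<ge> 1"
  have "{k. k < n \<and> k \<in> A} \<union> {k. k < n \<and> k \<in> - A} = {..<n}" by auto
  moreover have "card ({k. k < n \<and> k \<in> A} \<union> {k. k < n \<and> k \<in> - A}) =
      card {k. k < n \<and> k \<in> A} + card {k. k < n \<and> k \<in> - A}"
    by (rule card_Un_disjoint) auto
  ultimately have "card {k. k < n \<and> k \<in> A} + card {k. k < n \<and> k \<in> - A} = n"
    by (simp only: card_lessThan)
  then have "real (card {k. k < n \<and> k \<in> A}) + real (card {k. k < n \<and> k \<in> - A}) = real n"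
    by (simp only: of_nat_add [symmetric])
  then have "real (card {k. k < n \<and> k \<in> - A}) = real n - real (card {k. k < n \<and> k \<in> A})"
    by (simp only: eq_diff_eq add.commute)
  then show ?thesis using n unfolding rho_def by (simp only: diff_divide_distrib) simp
qed

lemma negligible_set_Compl_iff: "negligible_set (- A) \<longleftrightarrow> has_density A 1"
proof -
  have ev: "eventually (\<lambda>n. rho n (- A) = 1 - rho n A) sequentially"
    using eventually_ge_at_top [of 1] by (rule eventually_mono) (rule rho_Compl)
  have "(\<lambda>n. rho n (- A)) \<longlonglongrightarrow> 0 \<longleftrightarrow> (\<lambda>n. 1 - rho n A) \<longlonglongrightarrow> 0"
    using ev by (rule tendsto_cong)
  also have "\<dots> \<longleftrightarrow> (\<lambda>n. rho n A) \<longlonglongrightarrow> 1"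
  proof
    assume "(\<lambda>n. 1 - rho n A) \<longlonglongrightarrow> 0"
    from tendsto_diff [OF tendsto_const [of 1] this] show "(\<lambda>n. rho n A) \<longlonglongrightarrow> 1" by simp
  next
    assume "(\<lambda>n. rho n A) \<longlonglongrightarrow> 1"
    from tendsto_diff [OF tendsto_const [of 1] this] show "(\<lambda>n. 1 - rho n A) \<longlonglongrightarrow> 0" by simp
  qed
  finally show ?thesis by (simp add: negligible_set_def has_density_def)
qed

definition uniform_fun :: "(nat \<Rightarrow> nat) \<Rightarrow> bool" where
  "uniform_fun f \<longleftrightarrow> (\<forall>S. negligible_set S \<longrightarrow> negligible_set (f -` S))"

definition gm_reducible :: "nat set \<Rightarrow> nat set \<Rightarrow> bool" (infix \<open>\<le>\<^sub>g\<^sub>m\<close> 50) where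
  "A \<le>\<^sub>g\<^sub>m B \<longleftrightarrow> (\<exists>f. uniform_fun f \<and> computable_fun f \<and> (\<forall>x. x \<in> A \<longleftrightarrow> f x \<in> B))"

end

theory Submission imports Defs "HOL-Library.Infinite_Set" begin

text \<open>
  It suffices to find, for every non-negligible computable \<open>B\<close>, a uniform computable function with
  values in \<open>B\<close>: a reduction of \<open>A\<close> to \<open>B\<close> then uses such a function for \<open>B\<close> at the elements
  of \<open>A\<close> and one for the complement of \<open>B\<close> elsewhere.

  Let \<open>b\<close> enumerate \<open>B\<close> increasingly.  Since \<open>B\<close> is not negligible, there is a constant \<open>q\<close> such
  that \<open>b d \<le> q (d + 1)\<close> for infinitely many \<open>d\<close>; call these \<open>d\<close> good.  List
  \<open>b 0, b 1, b 2, \<dots>\<close> and start again from \<open>b 0\<close> as soon as the current index reaches the largest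
  good number not exceeding the current time.  A run that stops at the good number \<open>d\<close> takes
  \<open>d + 1\<close> steps, and it meets a negligible set \<open>S\<close> at most as often as \<open>S\<close> has elements up to
  \<open>q (d + 1)\<close>, which is \<open>o(d)\<close>.  The run in progress stays below a good number not exceeding the
  time, so it contributes a negligible amount as well.
\<close>

subsection \<open>Closure properties of the recursive functions\<close>

definition recursive :: "nat \<Rightarrow> (nat list \<Rightarrow> nat) \<Rightarrow> bool" where
  "recursive k F \<longleftrightarrow> (\<exists>r. \<forall>xs. length xs = k \<longrightarrow> rec_eval r xs (F xs))"

definition decidable :: "nat \<Rightarrow> (nat list \<Rightarrow> bool) \<Rightarrow> bool" where
  "decidable k P \<longleftrightarrow> recursive k (\<lambda>xs. of_bool (P xs))"

lemma recursiveI: "(\<And>xs. length xs = k \<Longrightarrow> rec_eval r xs (F xs)) \<Longrightarrow> recursive k F"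
  unfolding recursive_def by blast

lemma recursiveE:
  assumes "recursive k F"
  obtains r where "\<And>xs. length xs = k \<Longrightarrow> rec_eval r xs (F xs)"
  using assms unfolding recursive_def by blast

lemma recursive_cong:
  assumes "recursive k F" and "\<And>xs. length xs = k \<Longrightarrow> F xs = G xs"
  shows "recursive k G"
  using assms unfolding recursive_def by metis

lemma computable_fun_iff: "computable_fun f \<longleftrightarrow> recursive 1 (\<lambda>xs. f (xs ! 0))"
proof -
  have "(\<forall>x. rec_eval r [x] (f x)) \<longleftrightarrow> (\<forall>xs. length xs = 1 \<longrightarrow> rec_eval r xs (f (xs ! 0)))" for r
    by (auto simp: length_Suc_conv)
  then show ?thesis unfolding computable_fun_def recursive_def by simp
qed

lemma computable_set_iff: "computable_set A \<longleftrightarrow> decidable 1 (\<lambda>xs. xs ! 0 \<in> A)"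
  unfolding computable_set_def computable_fun_iff decidable_def of_bool_def ..

lemma recursive_nth: "i < k \<Longrightarrow> recursive k (\<lambda>xs. xs ! i)"
  by (rule recursiveI [of _ "Proj i"], rule rec_eval.Proj) simp

lemma recursive_compose:
  assumes "recursive (length Fs) G" and "\<And>F. F \<in> set Fs \<Longrightarrow> recursive k F"
  shows "recursive k (\<lambda>xs. G (map (\<lambda>F. F xs) Fs))"
proof -
  obtain r where eval_r: "\<And>ys. length ys = length Fs \<Longrightarrow> rec_eval r ys (G ys)"
    using assms(1) by (rule recursiveE) blast
  obtain s where eval_s: "\<And>F xs. F \<in> set Fs \<Longrightarrow> length xs = k \<Longrightarrow> rec_eval (s F) xs (F xs)"
    using assms(2) unfolding recursive_def by metis
  show ?thesis
  proof (rule recursiveI [of _ "Comp r (map s Fs)"], rule rec_eval.Comp)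
    fix xs :: "nat list" assume "length xs = k"
    then show "list_all2 (\<lambda>g y. rec_eval g xs y) (map s Fs) (map (\<lambda>F. F xs) Fs)"
      using eval_s by (auto simp: list_all2_conv_all_nth)
  qed (simp add: eval_r)
qed

lemma recursive_apply:
  assumes "computable_fun f" and "recursive k F"
  shows "recursive k (\<lambda>xs. f (F xs))"
  using recursive_compose [of "[F]" "\<lambda>ys. f (ys ! 0)" k] assms by (simp add: computable_fun_iff)

lemma recursive_Suc: "recursive k F \<Longrightarrow> recursive k (\<lambda>xs. Suc (F xs))"
  by (rule recursive_apply) (auto simp: computable_fun_def intro: rec_eval.Succ)

lemma recursive_const: "recursive k (\<lambda>xs. c)"
proof (induction c)
  case 0
  show ?case by (rule recursiveI, rule rec_eval.Zero)
next
  case (Suc c)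
  then show ?case by (rule recursive_Suc)
qed

lemma recursive_Cons:
  assumes "recursive (Suc k) G" and "recursive k F"
  shows "recursive k (\<lambda>xs. G (F xs # xs))"
proof -
  let ?Fs = "F # map (\<lambda>i xs. xs ! i) [0..<k]"
  have "recursive k (\<lambda>xs. G (map (\<lambda>F. F xs) ?Fs))"
    by (rule recursive_compose) (use assms in \<open>auto intro: recursive_nth\<close>)
  then show ?thesis
    by (rule recursive_cong) (auto simp: comp_def map_nth)
qed

lemma recursive_drop:
  assumes "recursive k F"
  shows "recursive (j + k) (\<lambda>xs. F (drop j xs))"
proof -
  let ?Fs = "map (\<lambda>i xs. xs ! (j + i)) [0..<k]"
  have "recursive (j + k) (\<lambda>xs. F (map (\<lambda>F. F xs) ?Fs))"
    by (rule recursive_compose) (use assms in \<open>auto intro: recursive_nth\<close>)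
  then show ?thesis
    by (rule recursive_cong) (auto simp: comp_def intro!: arg_cong [of _ _ F] nth_equalityI)
qed

lemma rec_eval_PrimRec:
  assumes "rec_eval r xs a" and "\<And>n y. rec_eval s (n # y # xs) (g n y)"
  shows "rec_eval (PrimRec r s) (n # xs) (rec_nat a g n)"
  by (induction n) (auto intro: rec_eval.PrimRec_0 rec_eval.PrimRec_Suc assms)

lemma recursive_rec_nat:
  assumes rec_F: "recursive k F" and rec_G: "recursive (2 + k) G" and rec_N: "recursive k N"
  shows "recursive k (\<lambda>xs. rec_nat (F xs) (\<lambda>n y. G (n # y # xs)) (N xs))"
proof -
  obtain r where eval_r: "\<And>xs. length xs = k \<Longrightarrow> rec_eval r xs (F xs)"
    using rec_F by (rule recursiveE) blast
  obtain s where eval_s: "\<And>xs. length xs = 2 + k \<Longrightarrow> rec_eval s xs (G xs)"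
    using rec_G by (rule recursiveE) blast
  have "recursive (Suc k) (\<lambda>ys. rec_nat (F (tl ys)) (\<lambda>n y. G (n # y # tl ys)) (hd ys))"
    by (rule recursiveI [of _ "PrimRec r s"])
      (auto simp: length_Suc_conv intro!: rec_eval_PrimRec eval_r eval_s)
  from recursive_Cons [OF this rec_N] show ?thesis by simp
qed

lemma computable_fun_primrec:
  assumes rec_h: "recursive 2 (\<lambda>xs. h (xs ! 0) (xs ! 1))" and f_Suc: "\<And>n. f (Suc n) = h n (f n)"
  shows "computable_fun f"
proof -
  obtain s where eval_s: "\<And>xs. length xs = 2 \<Longrightarrow> rec_eval s xs (h (xs ! 0) (xs ! 1))"
    using rec_h by (rule recursiveE) blast
  obtain r where eval_r: "rec_eval r [] (f 0)"
    using recursive_const [of 0 "f 0"] by (auto elim: recursiveE)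
  have "rec_eval (PrimRec r s) [n] (rec_nat (f 0) h n)" for n
    by (rule rec_eval_PrimRec [OF eval_r]) (use eval_s [of "[n, y]" for n y] in simp)
  moreover have "rec_nat (f 0) h n = f n" for n
    by (induction n) (simp_all add: f_Suc)
  ultimately show ?thesis unfolding computable_fun_def by auto
qed

lemma recursive_add:
  assumes "recursive k F" and "recursive k G"
  shows "recursive k (\<lambda>xs. F xs + G xs)"
proof -
  have "recursive k (\<lambda>xs. rec_nat (F xs) (\<lambda>n y. Suc ((n # y # xs) ! 1)) (G xs))"
    by (intro recursive_rec_nat recursive_Suc recursive_nth assms) simp
  moreover have "rec_nat m (\<lambda>n y. Suc y) n = m + n" for m n :: nat
    by (induction n) auto
  ultimately show ?thesis by simp
qed

lemma recursive_mult:
  assumes "recursive k F" and "recursive k G"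
  shows "recursive k (\<lambda>xs. F xs * G xs)"
proof -
  have "recursive k (\<lambda>xs. rec_nat 0 (\<lambda>n y. F (drop 2 (n # y # xs)) + (n # y # xs) ! 1) (G xs))"
    by (intro recursive_rec_nat recursive_const recursive_add recursive_drop recursive_nth assms)
      simp
  moreover have "rec_nat 0 (\<lambda>n y. m + y) n = m * n" for m n :: nat
    by (induction n) auto
  ultimately show ?thesis by simp
qed

lemma computable_fun_pred: "computable_fun (\<lambda>n. n - 1)"
proof (rule computable_fun_primrec)
  show "recursive 2 (\<lambda>xs. xs ! 0)" by (rule recursive_nth) simp
qed simp

lemma recursive_diff:
  assumes "recursive k F" and "recursive k G"
  shows "recursive k (\<lambda>xs. F xs - G xs)"
proof -
  have "recursive k (\<lambda>xs. rec_nat (F xs) (\<lambda>n y. (n # y # xs) ! 1 - 1) (G xs))"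
    by (intro recursive_rec_nat recursive_apply [OF computable_fun_pred] recursive_nth assms) simp
  moreover have "rec_nat m (\<lambda>n y. y - 1) n = m - n" for m n :: nat
    by (induction n) auto
  ultimately show ?thesis by simp
qed

lemma recursive_if:
  assumes "decidable k P" and "recursive k F" and "recursive k G"
  shows "recursive k (\<lambda>xs. if P xs then F xs else G xs)"
proof -
  have "recursive k (\<lambda>xs. rec_nat (G xs) (\<lambda>n y. F (drop 2 (n # y # xs))) (of_bool (P xs)))"
    using assms unfolding decidable_def by (intro recursive_rec_nat recursive_drop)
  then show ?thesis by (rule recursive_cong) simp
qed

lemma decidable_not:
  assumes "decidable k P"
  shows "decidable k (\<lambda>xs. \<not> P xs)"
proof -
  have "recursive k (\<lambda>xs. if P xs then 0 else 1)"
    by (intro recursive_if recursive_const assms)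
  then show ?thesis unfolding decidable_def by (rule recursive_cong) simp
qed

lemma decidable_conj:
  assumes "decidable k P" and "decidable k Q"
  shows "decidable k (\<lambda>xs. P xs \<and> Q xs)"
  using recursive_if [OF assms(1) assms(2) [unfolded decidable_def] recursive_const [of k 0]]
  unfolding decidable_def by (rule recursive_cong) simp

lemma decidable_le:
  assumes "recursive k F" and "recursive k G"
  shows "decidable k (\<lambda>xs. F xs \<le> G xs)"
proof -
  have "recursive k (\<lambda>xs. 1 - (F xs - G xs))"
    by (intro recursive_diff recursive_const assms)
  then show ?thesis unfolding decidable_def by (rule recursive_cong) auto
qed

lemma decidable_less:
  assumes "recursive k F" and "recursive k G"
  shows "decidable k (\<lambda>xs. F xs < G xs)"
  using decidable_le [OF recursive_Suc [OF assms(1)] assms(2)] by (simp add: Suc_le_eq)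

lemma decidable_mem:
  assumes "computable_set A" and "recursive k F"
  shows "decidable k (\<lambda>xs. F xs \<in> A)"
  using recursive_apply [OF _ assms(2)] assms(1)
  unfolding computable_set_def decidable_def of_bool_def by blast

lemma recursive_Least:
  assumes decidable_P: "decidable (Suc k) P" and ex_P: "\<And>xs. length xs = k \<Longrightarrow> \<exists>n. P (n # xs)"
  shows "recursive k (\<lambda>xs. LEAST n. P (n # xs))"
proof -
  obtain r where eval_r: "\<And>ys. length ys = Suc k \<Longrightarrow> rec_eval r ys (of_bool (\<not> P ys))"
    using decidable_not [OF decidable_P] unfolding decidable_def by (rule recursiveE) blast
  show ?thesis
  proof (rule recursiveI, rule rec_eval.Mu)
    fix xs :: "nat list" assume length_xs: "length xs = k"
    have "P ((LEAST n. P (n # xs)) # xs)"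
      using ex_P [OF length_xs] by (rule LeastI_ex)
    then show "rec_eval r ((LEAST n. P (n # xs)) # xs) 0"
      using eval_r [of "(LEAST n. P (n # xs)) # xs"] length_xs by simp
    show "\<forall>m<LEAST n. P (n # xs). \<exists>y. rec_eval r (m # xs) (Suc y)"
    proof (intro allI impI exI)
      fix m assume "m < (LEAST n. P (n # xs))"
      then have "\<not> P (m # xs)" by (rule not_less_Least)
      then show "rec_eval r (m # xs) (Suc 0)" using eval_r [of "m # xs"] length_xs by simp
    qed
  qed
qed

lemma computable_fun_comp: "computable_fun f \<Longrightarrow> computable_fun g \<Longrightarrow> computable_fun (f \<circ> g)"
  unfolding comp_def computable_fun_iff [of g] computable_fun_iff [of "\<lambda>x. f (g x)"]
  by (rule recursive_apply)

lemma computable_fun_if: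
  assumes "computable_set A" and "computable_fun g" and "computable_fun h"
  shows "computable_fun (\<lambda>x. if x \<in> A then g x else h x)"
  using assms unfolding computable_fun_iff computable_set_iff by (rule recursive_if)

lemma computable_set_Compl: "computable_set A \<Longrightarrow> computable_set (- A)"
  by (simp add: computable_set_iff decidable_not)

lemma computable_fun_enumerate:
  assumes computable_B: "computable_set B" and infinite_B: "infinite B"
  shows "computable_fun (enumerate B)"
proof (rule computable_fun_primrec)
  have "recursive 2 (\<lambda>xs. LEAST s. (s # xs) ! 0 \<in> B \<and> (s # xs) ! 2 < (s # xs) ! 0)"
  proof (rule recursive_Least)
    show "decidable (Suc 2) (\<lambda>ys. ys ! 0 \<in> B \<and> ys ! 2 < ys ! 0)"
      by (intro decidable_conj decidable_mem [OF computable_B] decidable_less recursive_nth)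
        simp_all
    show "\<exists>s. (s # xs) ! 0 \<in> B \<and> (s # xs) ! 2 < (s # xs) ! 0" for xs
      using infinite_B unfolding infinite_nat_iff_unbounded by auto
  qed
  then show "recursive 2 (\<lambda>xs. LEAST s. s \<in> B \<and> xs ! 1 < s)" by simp
  show "enumerate B (Suc n) = (LEAST s. s \<in> B \<and> enumerate B n < s)" for n
    by (rule enumerate_Suc'' [OF infinite_B])
qed

subsection \<open>Negligible sets\<close>

definition card_below :: "nat \<Rightarrow> nat set \<Rightarrow> nat" where
  "card_below n A = card {k. k < n \<and> k \<in> A}"

lemma card_below_0 [simp]: "card_below 0 A = 0"
  by (simp add: card_below_def)

lemma card_below_Suc: "card_below (Suc n) A = card_below n A + of_bool (n \<in> A)"
proof -
  have "{k. k < Suc n \<and> k \<in> A} = {k. k < n \<and> k \<in> A} \<union> (if n \<in> A then {n} else {})"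
    by (auto simp: less_Suc_eq)
  then show ?thesis by (simp add: card_below_def)
qed

lemma card_below_le: "card_below n A \<le> n"
  by (induction n) (auto simp: card_below_Suc)

lemma card_below_mono: "m \<le> n \<Longrightarrow> A \<subseteq> B \<Longrightarrow> card_below m A \<le> card_below n B"
  unfolding card_below_def by (rule card_mono) auto

lemma card_below_Un_le: "card_below n (A \<union> B) \<le> card_below n A + card_below n B"
  by (induction n) (auto simp: card_below_Suc)

lemma card_below_le_card: "finite A \<Longrightarrow> card_below n A \<le> card A"
  unfolding card_below_def by (rule card_mono) auto

lemma card_below_vimage_le:
  assumes "inj f" and "\<And>k. k < n \<Longrightarrow> f k < m"
  shows "card_below n (f -` A) \<le> card_below m A"
  unfolding card_below_def
proof (rule card_inj_on_le)
  show "inj_on f {k. k < n \<and> k \<in> f -` A}"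
    using assms(1) by (rule inj_on_subset) simp
qed (use assms(2) in auto)

lemma rho_le_inverse_iff:
  assumes "0 < n" and "0 < q"
  shows "rho n A \<le> inverse (real q) \<longleftrightarrow> q * card_below n A \<le> n"
proof -
  have "rho n A \<le> inverse (real q) \<longleftrightarrow> real q * real (card_below n A) \<le> real n"
    using assms by (simp add: rho_def card_below_def field_simps)
  then show ?thesis by (simp only: of_nat_mult [symmetric] of_nat_le_iff)
qed

lemma negligible_set_iff:
  "negligible_set A \<longleftrightarrow> (\<forall>q. \<forall>\<^sub>F n in sequentially. q * card_below n A \<le> n)"
proof
  assume negligible_A: "negligible_set A"
  show "\<forall>q. \<forall>\<^sub>F n in sequentially. q * card_below n A \<le> n"
  proof
    fix q
    have "\<forall>\<^sub>F n in sequentially. rho n A < inverse (Suc q)"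
      using negligible_A unfolding negligible_set_def has_density_def by (rule order_tendstoD) simp
    then show "\<forall>\<^sub>F n in sequentially. q * card_below n A \<le> n"
      using eventually_gt_at_top [of 0]
    proof eventually_elim
      case (elim n)
      then have "Suc q * card_below n A \<le> n"
        using rho_le_inverse_iff [of n "Suc q" A] by simp
      then show ?case by simp
    qed
  qed
next
  assume card_bound: "\<forall>q. \<forall>\<^sub>F n in sequentially. q * card_below n A \<le> n"
  show "negligible_set A"
    unfolding negligible_set_def has_density_def
  proof (rule tendstoI)
    fix e :: real assume "e > 0"
    then obtain q where inverse_q_less: "inverse (real (Suc q)) < e"
      using reals_Archimedean by blast
    from card_bound have "\<forall>\<^sub>F n in sequentially. Suc q * card_below n A \<le> n" ..
    then show "\<forall>\<^sub>F n in sequentially. dist (rho n A) 0 < e"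
      using eventually_gt_at_top [of 0]
    proof eventually_elim
      case (elim n)
      then have "rho n A \<le> inverse (Suc q)"
        by (simp only: rho_le_inverse_iff zero_less_Suc)
      then show ?case using inverse_q_less by (simp add: rho_def)
    qed
  qed
qed

lemma negligible_set_subset:
  assumes "negligible_set B" and "A \<subseteq> B"
  shows "negligible_set A"
  unfolding negligible_set_iff
proof
  fix q
  have "\<forall>\<^sub>F n in sequentially. q * card_below n B \<le> n"
    using assms(1) unfolding negligible_set_iff ..
  then show "\<forall>\<^sub>F n in sequentially. q * card_below n A \<le> n"
  proof (rule eventually_mono)
    fix n assume "q * card_below n B \<le> n"
    moreover have "q * card_below n A \<le> q * card_below n B"
      by (intro mult_le_mono2 card_below_mono assms(2) order_refl)
    ultimately show "q * card_below n A \<le> n" by linarith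
  qed
qed

lemma negligible_set_Un:
  assumes "negligible_set A" and "negligible_set B"
  shows "negligible_set (A \<union> B)"
  unfolding negligible_set_iff
proof
  fix q
  have "\<forall>\<^sub>F n in sequentially. 2 * q * card_below n A \<le> n"
    and "\<forall>\<^sub>F n in sequentially. 2 * q * card_below n B \<le> n"
    using assms unfolding negligible_set_iff by blast+
  then show "\<forall>\<^sub>F n in sequentially. q * card_below n (A \<union> B) \<le> n"
  proof eventually_elim
    case (elim n)
    have "q * card_below n (A \<union> B) \<le> q * card_below n A + q * card_below n B"
      unfolding distrib_left [symmetric] by (intro mult_le_mono2 card_below_Un_le)
    then show ?case using elim by simp
  qed
qed

lemma finite_imp_negligible_set:
  assumes "finite A"
  shows "negligible_set A"
  unfolding negligible_set_iff
proof
  fix q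
  show "\<forall>\<^sub>F n in sequentially. q * card_below n A \<le> n"
  proof (rule eventually_sequentiallyI)
    fix n assume "q * card A \<le> n"
    moreover have "q * card_below n A \<le> q * card A"
      by (intro mult_le_mono2 card_below_le_card assms)
    ultimately show "q * card_below n A \<le> n" by linarith
  qed
qed

lemma enumerate_less_if_less_card_below:
  assumes "infinite B" and "d < card_below n B"
  shows "enumerate B d < n"
proof (rule ccontr)
  assume "\<not> enumerate B d < n"
  then have n_le: "n \<le> enumerate B d" by simp
  have "{k. k < n \<and> k \<in> B} \<subseteq> enumerate B ` {..<d}"
  proof
    fix k assume k_in_B: "k \<in> {k. k < n \<and> k \<in> B}"
    then obtain i where k_eq: "k = enumerate B i" using enumerate_Ex [of B k] assms(1) by auto
    with k_in_B have "enumerate B i < enumerate B d" using n_le by simp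
    then have "i < d" using strict_mono_less [OF strict_mono_enumerate [OF assms(1)]] by simp
    with k_eq show "k \<in> enumerate B ` {..<d}" by simp
  qed
  from surj_card_le [OF _ this] have "card_below n B \<le> d" by (simp add: card_below_def)
  with assms(2) show False by simp
qed

definition good_indices :: "(nat \<Rightarrow> nat) \<Rightarrow> nat \<Rightarrow> nat set" where
  "good_indices b q = {d. b d \<le> q * Suc d}"

lemma computable_set_good_indices:
  assumes "computable_fun b"
  shows "computable_set (good_indices b q)"
proof -
  have "decidable 1 (\<lambda>xs. b (xs ! 0) \<le> q * Suc (xs ! 0))"
    by (intro decidable_le recursive_apply [OF assms] recursive_mult recursive_const recursive_Suc
        recursive_nth) simp_all
  then show ?thesis by (simp add: computable_set_iff good_indices_def)
qed

lemma not_negligible_set_infinite_good_indices: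
  assumes "\<not> negligible_set B"
  obtains q where "infinite (good_indices (enumerate B) q)"
proof (rule ccontr)
  assume "\<not> thesis"
  then have "finite (good_indices (enumerate B) q)" for q
    using that by blast
  then have "\<exists>m. \<forall>d\<ge>m. q * Suc d < enumerate B d" for q
    unfolding good_indices_def finite_nat_set_iff_bounded by (metis linorder_not_le mem_Collect_eq)
  then obtain m where enumerate_large: "\<And>q d. m q \<le> d \<Longrightarrow> q * Suc d < enumerate B d"
    by metis
  have infinite_B: "infinite B" using assms finite_imp_negligible_set by blast
  have "q * card_below n B \<le> n" if n_large: "q * m q \<le> n" for q n
  proof (cases "card_below n B \<le> m q")
    case True
    then show ?thesis using n_large by (meson mult_le_mono2 order_trans)
  next
    case False
    then obtain d where card_eq: "card_below n B = Suc d" and d_ge: "m q \<le> d"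
      by (cases "card_below n B") auto
    have "q * Suc d < enumerate B d" using d_ge by (rule enumerate_large)
    also have "\<dots> < n"
      using card_eq by (intro enumerate_less_if_less_card_below [OF infinite_B]) simp
    finally show ?thesis using card_eq by simp
  qed
  then have "negligible_set B"
    unfolding negligible_set_iff by (meson eventually_sequentiallyI)
  with assms show False ..
qed

subsection \<open>Restarting walks\<close>

primrec latest_in :: "nat set \<Rightarrow> nat \<Rightarrow> nat" where
  "latest_in G 0 = 0"
| "latest_in G (Suc x) = (if Suc x \<in> G then Suc x else latest_in G x)"

primrec restart_walk :: "nat set \<Rightarrow> nat \<Rightarrow> nat" where
  "restart_walk G 0 = 0"
| "restart_walk G (Suc x) =
    (if restart_walk G x < latest_in G x then Suc (restart_walk G x) else 0)"

definition negligible_along :: "nat set \<Rightarrow> nat set \<Rightarrow> bool" where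
  "negligible_along G T \<longleftrightarrow>
    (\<forall>q. \<forall>\<^sub>F d in sequentially. d \<in> G \<longrightarrow> q * card_below (Suc d) T \<le> Suc d)"

lemma computable_fun_latest_in:
  assumes "computable_set G"
  shows "computable_fun (latest_in G)"
proof (rule computable_fun_primrec)
  show "recursive 2 (\<lambda>xs. if Suc (xs ! 0) \<in> G then Suc (xs ! 0) else xs ! 1)"
    by (intro recursive_if decidable_mem [OF assms] recursive_Suc recursive_nth) simp_all
qed simp

lemma computable_fun_restart_walk:
  assumes "computable_set G"
  shows "computable_fun (restart_walk G)"
proof (rule computable_fun_primrec)
  show "recursive 2 (\<lambda>xs. if xs ! 1 < latest_in G (xs ! 0) then Suc (xs ! 1) else 0)"
    by (intro recursive_if decidable_less recursive_Suc recursive_const recursive_nth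
        recursive_apply [OF computable_fun_latest_in [OF assms]]) simp_all
qed simp

lemma latest_in_le: "latest_in G x \<le> x"
  by (induction x) auto

lemma latest_in_mem: "d \<in> G \<Longrightarrow> d \<le> x \<Longrightarrow> latest_in G x \<in> G"
  by (induction x) (auto simp: le_Suc_eq)

lemma latest_in_ge: "d \<in> G \<Longrightarrow> d \<le> x \<Longrightarrow> d \<le> latest_in G x"
  by (induction x) (auto simp: le_Suc_eq)

lemma restart_walk_le_latest_in: "restart_walk G x \<le> latest_in G x"
proof (induction x)
  case (Suc x)
  then show ?case using latest_in_le [of G x] by auto
qed simp

text \<open>
  Completed runs meet \<open>T\<close> with frequency at most \<open>1 / q\<close>; the current run has met it exactly
  \<open>card_below (restart_walk G x) T\<close> times.
\<close>
lemma card_below_vimage_restart_walk_le: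
  assumes m_in_G: "m \<in> G"
    and T_sparse: "\<And>d. d \<in> G \<Longrightarrow> m \<le> d \<Longrightarrow> q * card_below (Suc d) T \<le> Suc d"
    and "m \<le> x"
  shows "q * card_below x (restart_walk G -` T) + restart_walk G x
      \<le> x + q * m + q * card_below (restart_walk G x) T"
  using \<open>m \<le> x\<close>
proof (induction x rule: dec_induct)
  case base
  have "restart_walk G m \<le> m"
    using restart_walk_le_latest_in latest_in_le by (rule order_trans)
  moreover have "q * card_below m (restart_walk G -` T) \<le> q * m"
    by (intro mult_le_mono2 card_below_le)
  ultimately show ?case by linarith
next
  case (step x)
  show ?case
  proof (cases "restart_walk G x < latest_in G x")
    case True
    then show ?thesis using step.IH by (simp add: card_below_Suc algebra_simps)
  next
    case False
    define d where "d = latest_in G x"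
    have run_ends: "restart_walk G x = d"
      using False restart_walk_le_latest_in [of G x] by (simp add: d_def)
    have "q * card_below (Suc d) T \<le> Suc d"
      unfolding d_def by (intro T_sparse latest_in_mem [OF m_in_G] latest_in_ge [OF m_in_G]
          step.hyps)
    then show ?thesis using step.IH False by (simp add: card_below_Suc run_ends algebra_simps)
  qed
qed

lemma negligible_set_vimage_restart_walk:
  assumes "infinite G" and "negligible_along G T"
  shows "negligible_set (restart_walk G -` T)"
  unfolding negligible_set_iff
proof
  fix q
  have "\<forall>\<^sub>F d in sequentially. d \<in> G \<longrightarrow> 3 * q * card_below (Suc d) T \<le> Suc d"
    using assms(2) unfolding negligible_along_def ..
  then obtain l where sparse_from_l: "\<And>d. d \<in> G \<Longrightarrow> l \<le> d \<Longrightarrow> 3 * q * card_below (Suc d) T \<le> Suc d"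
    unfolding eventually_sequentially by blast
  obtain m where m_in_G: "m \<in> G" and l_le_m: "l \<le> m"
    using assms(1) unfolding infinite_nat_iff_unbounded_le by blast
  have T_sparse: "3 * q * card_below (Suc d) T \<le> Suc d" if "d \<in> G" "m \<le> d" for d
    using that l_le_m by (intro sparse_from_l) simp_all
  have "q * card_below x (restart_walk G -` T) \<le> x" if x_large: "m + 3 * q * m + 1 \<le> x" for x
  proof -
    let ?w = "restart_walk G x" and ?d = "latest_in G x"
    have m_le_x: "m \<le> x" using x_large by simp
    have "3 * q * card_below ?w T \<le> 3 * q * card_below (Suc ?d) T"
      by (intro mult_le_mono2 card_below_mono le_SucI restart_walk_le_latest_in order_refl)
    also have "\<dots> \<le> Suc ?d"
      by (intro T_sparse latest_in_mem [OF m_in_G m_le_x] latest_in_ge [OF m_in_G m_le_x])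
    also have "\<dots> \<le> Suc x" using latest_in_le by simp
    finally have "3 * q * card_below x (restart_walk G -` T) \<le> x + 3 * q * m + Suc x"
      using card_below_vimage_restart_walk_le [OF m_in_G T_sparse m_le_x] by linarith
    then show ?thesis using x_large by simp
  qed
  then show "\<forall>\<^sub>F x in sequentially. q * card_below x (restart_walk G -` T) \<le> x"
    by (rule eventually_sequentiallyI)
qed

lemma negligible_along_vimage_strict_mono:
  assumes mono_b: "strict_mono b" and negligible_S: "negligible_set S"
  shows "negligible_along (good_indices b q) (b -` S)"
  unfolding negligible_along_def
proof
  fix p
  have "\<forall>\<^sub>F n in sequentially. p * Suc q * card_below n S \<le> n"
    using negligible_S unfolding negligible_set_iff ..
  moreover have "filterlim (\<lambda>d. Suc q * Suc d) sequentially sequentially"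
    by (rule filterlim_subseq) (simp add: strict_mono_Suc_iff)
  ultimately have
    "\<forall>\<^sub>F d in sequentially. p * Suc q * card_below (Suc q * Suc d) S \<le> Suc q * Suc d"
    by (rule eventually_compose_filterlim)
  then show "\<forall>\<^sub>F d in sequentially.
      d \<in> good_indices b q \<longrightarrow> p * card_below (Suc d) (b -` S) \<le> Suc d"
  proof (rule eventually_mono, intro impI)
    fix d
    assume sparse: "p * Suc q * card_below (Suc q * Suc d) S \<le> Suc q * Suc d"
      and good: "d \<in> good_indices b q"
    have "b k < Suc q * Suc d" if "k < Suc d" for k
    proof -
      have "b k \<le> b d" using that strict_mono_less_eq [OF mono_b] by simp
      then show ?thesis using good by (simp add: good_indices_def)
    qed
    then have "p * card_below (Suc d) (b -` S) \<le> p * card_below (Suc q * Suc d) S"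
      by (intro mult_le_mono2 card_below_vimage_le strict_mono_imp_inj_on [OF mono_b])
    also have "\<dots> \<le> Suc d"
    proof -
      have "Suc q * (p * card_below (Suc q * Suc d) S) \<le> Suc q * Suc d"
        using sparse by (simp only: ac_simps)
      then show ?thesis by (simp only: Suc_mult_le_cancel1)
    qed
    finally show "p * card_below (Suc d) (b -` S) \<le> Suc d" .
  qed
qed

subsection \<open>Uniform functions and generic reducibility\<close>

lemma uniform_fun_comp_restart_walk:
  assumes "strict_mono b" and "infinite (good_indices b q)"
  shows "uniform_fun (b \<circ> restart_walk (good_indices b q))"
  unfolding uniform_fun_def vimage_comp [symmetric]
  by (intro allI impI negligible_set_vimage_restart_walk negligible_along_vimage_strict_mono assms)

lemma uniform_fun_if:
  assumes "uniform_fun g" and "uniform_fun h"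
  shows "uniform_fun (\<lambda>x. if x \<in> A then g x else h x)"
  unfolding uniform_fun_def
proof (intro allI impI)
  fix S assume "negligible_set S"
  then have "negligible_set (g -` S \<union> h -` S)"
    using assms unfolding uniform_fun_def by (blast intro: negligible_set_Un)
  then show "negligible_set ((\<lambda>x. if x \<in> A then g x else h x) -` S)"
    by (rule negligible_set_subset) (auto split: if_splits)
qed

lemma computable_uniform_fun_into:
  assumes computable_B: "computable_set B" and "\<not> negligible_set B"
  obtains g where "uniform_fun g" and "computable_fun g" and "\<And>x. g x \<in> B"
proof -
  have infinite_B: "infinite B" using assms(2) finite_imp_negligible_set by blast
  obtain q where infinite_good: "infinite (good_indices (enumerate B) q)"
    using assms(2) by (rule not_negligible_set_infinite_good_indices)
  define G where "G = good_indices (enumerate B) q"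
  have computable_enum: "computable_fun (enumerate B)"
    by (rule computable_fun_enumerate [OF computable_B infinite_B])
  have computable_G: "computable_set G"
    unfolding G_def by (rule computable_set_good_indices [OF computable_enum])
  show thesis
  proof (rule that)
    show "uniform_fun (enumerate B \<circ> restart_walk G)"
      unfolding G_def
      by (intro uniform_fun_comp_restart_walk strict_mono_enumerate infinite_B infinite_good)
    show "computable_fun (enumerate B \<circ> restart_walk G)"
      by (intro computable_fun_comp computable_enum computable_fun_restart_walk computable_G)
    show "(enumerate B \<circ> restart_walk G) x \<in> B" for x
      by (simp add: enumerate_in_set [OF infinite_B])
  qed
qed

lemma computable_set_imp_gm_reducible:
  assumes "computable_set A" and "computable_set B"
    and "\<not> negligible_set B" and "\<not> negligible_set (- B)"
  shows "A \<le>\<^sub>g\<^sub>m B"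
proof -
  obtain g where uniform_g: "uniform_fun g" and computable_g: "computable_fun g"
      and g_in: "\<And>x. g x \<in> B"
    using assms(2,3) by (rule computable_uniform_fun_into) blast
  obtain h where uniform_h: "uniform_fun h" and computable_h: "computable_fun h"
      and h_notin: "\<And>x. h x \<in> - B"
    using computable_set_Compl [OF assms(2)] assms(4) by (rule computable_uniform_fun_into) blast
  have "x \<in> A \<longleftrightarrow> (if x \<in> A then g x else h x) \<in> B" for x
    using g_in h_notin by auto
  then show ?thesis
    using uniform_fun_if [OF uniform_g uniform_h]
      computable_fun_if [OF assms(1) computable_g computable_h]
    unfolding gm_reducible_def by blast
qed

theorem theorem1:
  "(\<forall>A B :: nat set.
      computable_set A \<and> computable_set B \<and> \<not> negligible_set B \<and> \<not> negligible_set (- B)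
      \<longrightarrow> A \<le>\<^sub>g\<^sub>m B) \<and>
   (\<forall>A B :: nat set.
      computable_set A \<and> computable_set B \<and>
      \<not> negligible_set A \<and> \<not> negligible_set (- A) \<and> \<not> negligible_set B \<and> \<not> negligible_set (- B)
      \<longrightarrow> A \<le>\<^sub>g\<^sub>m B \<and> B \<le>\<^sub>g\<^sub>m A)"
  by (blast intro: computable_set_imp_gm_reducible)

end
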